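(* For every relation $r\subseteq\Sigma\times\Sigma$ and every variable $x\in V$, $$\mathsf E_x(\mathbf{rely}\,r)=\mathbf{rely}(\mathsf A_xr),$$ where $\mathsf A_xr=\overline{\mathsf E_x\overline r}$.
   Context: Commands. $(\mathcal C,\le,\bigwedge,\bigsqcup,\bot,\top)$ is a complete distributive lattice (with arbitrary meet $\bigwedge$, binary meet $\sqcap$, arbitrary join $\bigsqcup$ and binary join $\sqcup$) whose elements are called commands. It has an associative sequential composition $;$ with identity $\mathbf{nil}$, monotone in both arguments, and an associative, commutative, idempotent, monotone weak conjunction $\Cap$. Iterations: $c^0=\mathbf{nil}$, $c^{i+1}=c;c^i$; $c^\star$ (resp. $c^\omega$) is the least (resp. greatest) fixed point of $y\mapsto\mathbf{nil}\sqcup c;y$; $c^\infty=c^\omega;\bot$. One has $c^\star=\bigsqcup_{i\in\mathbb N}c^i$ and $c^\omega=c^\star\sqcup c^\infty$. States and relations. $V$ is a countable set of variables, $S$ a set, $\Sigma$ the set of partial functions $V\rightharpoonup S$. $\mathrm{id}(\overline x)$ relates $\sigma,\sigma'\in\Sigma$ iff they agree on every variable other than $x$. For $p\subseteq\Sigma$, $\mathsf E_x p$ is the image of $p$ under $\mathrm{id}(\overline x)$. For $r\subseteq\Sigma\times\Sigma$ (with $\circ$ denoting left-to-right relational composition), $\mathsf E^{\mathsf{first}}_x r=\mathrm{id}(\overline x)\circ r$, $\mathsf E^{\mathsf{last}}_x r=r\circ\mathrm{id}(\overline x)$, $\mathsf E_x r=\mathrm{id}(\overline x)\circ r\circ\mathrm{id}(\overline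 x)$. $\overline r$ is the complement of $r$ in $\Sigma\times\Sigma$. Primitive commands. $\tau:\mathcal P(\Sigma)\to\mathcal C$ (tests) and $\pi,\epsilon:\mathcal P(\Sigma\times\Sigma)\to\mathcal A$ (program and environment steps) are injective homomorphisms of complete Boolean algebras onto complete Boolean sub-algebras of $\mathcal C$ (joins, and nonempty meets, computed in $\mathcal C$; complement relative to the greatest element of the sub-algebra), with $\tau(\emptyset)=\pi(\emptyset)=\epsilon(\emptyset)=\bot$ and $\tau(\Sigma)=\mathbf{nil}$. $\mathcal A\subseteq\mathcal C$ is the complete Boolean sub-algebra of atomic steps, in which $\boldsymbol\pi=\pi(\Sigma\times\Sigma)$ and $\boldsymbol\epsilon=\epsilon(\Sigma\times\Sigma)$ are complementary; $\boldsymbol\alpha=\boldsymbol\pi\sqcup\boldsymbol\epsilon$. $\mathbf{chaos}=\boldsymbol\alpha^\omega$ is the identity of $\Cap$, and $a=a\Cap(\boldsymbol\alpha;\mathbf{chaos})$ for all $a\in\mathcal A$. Localisation. For each $x\in V$ there are unary operators $\mathsf E_x,\mathsf E^{\mathsf{first}}_x,\mathsf E^{\mathsf{last}}_x$ on $\mathcal C$ (binding tighter than binary operators). Each family $F\in\{\mathsf E,\mathsf E^{\mathsf{first}},\mathsf E^{\mathsf{last}}\}$ satisfies $c\le F_xc$; $F_x(c\sqcap F_xd)=F_xc\sqcap F_xd$; $F_xF_yc=F_yF_xc$; $F_x(\bigsqcup C)=\bigsqcup_{c\in C}F_xc$. Further axioms: $\mathsf E^{\mathsf{first}}_xc\le\mathsf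 E_xc$; $\mathsf E^{\mathsf{last}}_xc\le\mathsf E_xc$; $\mathsf E_x\mathsf E^{\mathsf{first}}_yc=\mathsf E^{\mathsf{first}}_y\mathsf E_xc$; $\mathsf E_x\mathsf E^{\mathsf{last}}_yc=\mathsf E^{\mathsf{last}}_y\mathsf E_xc$; $\mathsf E^{\mathsf{first}}_x\mathsf E^{\mathsf{last}}_yc=\mathsf E^{\mathsf{last}}_y\mathsf E^{\mathsf{first}}_xc$; $\mathsf E_x\tau(p)=\mathsf E^{\mathsf{first}}_x\tau(p)=\mathsf E^{\mathsf{last}}_x\tau(p)=\tau(\mathsf E_xp)$; $F_x\pi(r)=\pi(F_xr)$ and $F_x\epsilon(r)=\epsilon(F_xr)$ for each of the three $F$; $\mathsf E_x(c;\mathsf E^{\mathsf{first}}_xd)=\mathsf E_xc;\mathsf E_xd=\mathsf E_x(\mathsf E^{\mathsf{last}}_xc;d)$; if $c=c\Cap(\boldsymbol\alpha;\mathbf{chaos})$ then $\mathsf E^{\mathsf{first}}_x(c;d)=\mathsf E^{\mathsf{first}}_xc;d$ and $\mathsf E^{\mathsf{last}}_x(d;c)=d;\mathsf E^{\mathsf{last}}_xc$; $\mathsf E_x(c\Cap\mathsf E_xd)=\mathsf E_xc\Cap\mathsf E_xd$; $\mathsf E^{\mathsf{first}}_x(c\Cap\mathsf E^{\mathsf{first}}_xd)=\mathsf E^{\mathsf{first}}_xc\Cap\mathsf E^{\mathsf{first}}_xd$. Rely command. $\mathbf{rely}\,r=(\boldsymbol\alpha\sqcup\epsilon(\overline r);\top)^\omega$,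 and in this algebra $\mathbf{rely}\,r=\boldsymbol\alpha^\omega;(\mathbf{nil}\sqcup\epsilon(\overline r);\top)$. *)

theory Defs
  imports Main "HOL-Library.Countable_Set"
begin

unbundle lattice_syntax

section \<open>States and relations\<close>

definition states :: "'v set \<Rightarrow> 's set \<Rightarrow> ('v \<rightharpoonup> 's) set" where
  "states V S = {\<sigma>. dom \<sigma> \<subseteq> V \<and> ran \<sigma> \<subseteq> S}"

definition id_except :: "'v set \<Rightarrow> 's set \<Rightarrow> 'v \<Rightarrow> ('v \<rightharpoonup> 's) rel" where
  "id_except V S x =
     {(\<sigma>, \<sigma>'). \<sigma> \<in> states V S \<and> \<sigma>' \<in> states V S \<and> (\<forall>y\<in>V. y \<noteq> x \<longrightarrow> \<sigma> y = \<sigma>' y)}"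

definition exists_set :: "'v set \<Rightarrow> 's set \<Rightarrow> 'v \<Rightarrow> ('v \<rightharpoonup> 's) set \<Rightarrow> ('v \<rightharpoonup> 's) set" where
  "exists_set V S x p = id_except V S x `` p"

definition exists_first :: "'v set \<Rightarrow> 's set \<Rightarrow> 'v \<Rightarrow> ('v \<rightharpoonup> 's) rel \<Rightarrow> ('v \<rightharpoonup> 's) rel" where
  "exists_first V S x r = id_except V S x O r"

definition exists_last :: "'v set \<Rightarrow> 's set \<Rightarrow> 'v \<Rightarrow> ('v \<rightharpoonup> 's) rel \<Rightarrow> ('v \<rightharpoonup> 's) rel" where
  "exists_last V S x r = r O id_except V S x"

definition exists_rel :: "'v set \<Rightarrow> 's set \<Rightarrow> 'v \<Rightarrow> ('v \<rightharpoonup> 's) rel \<Rightarrow> ('v \<rightharpoonup> 's) rel" where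
  "exists_rel V S x r = id_except V S x O r O id_except V S x"

definition rel_compl :: "'v set \<Rightarrow> 's set \<Rightarrow> ('v \<rightharpoonup> 's) rel \<Rightarrow> ('v \<rightharpoonup> 's) rel" where
  "rel_compl V S r = (states V S \<times> states V S) - r"

definition forall_rel :: "'v set \<Rightarrow> 's set \<Rightarrow> 'v \<Rightarrow> ('v \<rightharpoonup> 's) rel \<Rightarrow> ('v \<rightharpoonup> 's) rel" where
  "forall_rel V S x r = rel_compl V S (exists_rel V S x (rel_compl V S r))"

section \<open>Complete Boolean sub-algebras\<close>

text \<open>Taking \<open>X = {}\<close> in the first clause puts \<open>\<bottom>\<close> in the sub-algebra. Its greatest element
  \<open>\<Squnion>B\<close> need not be \<open>\<top>\<close>; meets of empty families and complements are relative to \<open>\<Squnion>B\<close>.\<close>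

definition complete_boolean_subalgebra :: "'c::complete_lattice set \<Rightarrow> bool" where
  "complete_boolean_subalgebra B \<longleftrightarrow>
     (\<forall>X\<subseteq>B. \<Squnion>X \<in> B) \<and>
     (\<forall>X\<subseteq>B. X \<noteq> {} \<longrightarrow> \<Sqinter>X \<in> B) \<and>
     (\<forall>b\<in>B. \<exists>b'\<in>B. b \<sqinter> b' = \<bottom> \<and> b \<squnion> b' = \<Squnion>B)"

text \<open>An injective homomorphism from the powerset algebra of \<open>U\<close> onto such a sub-algebra.\<close>

definition complete_boolean_embedding :: "'a set \<Rightarrow> ('a set \<Rightarrow> 'c::complete_lattice) \<Rightarrow> bool" where
  "complete_boolean_embedding U f \<longleftrightarrow>
     inj_on f (Pow U) \<and>
     complete_boolean_subalgebra (f ` Pow U) \<and>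
     (\<forall>P\<subseteq>Pow U. f (\<Union>P) = \<Squnion>(f ` P)) \<and>
     (\<forall>P\<subseteq>Pow U. P \<noteq> {} \<longrightarrow> f (\<Inter>P) = \<Sqinter>(f ` P)) \<and>
     (\<forall>p\<subseteq>U. f p \<sqinter> f (U - p) = \<bottom> \<and> f p \<squnion> f (U - p) = f U)"

section \<open>Commands\<close>

text \<open>The sort asks only for completeness and binary distributivity; Isabelle's class
  \<open>complete_distrib_lattice\<close> would demand full complete distributivity.\<close>

locale command_signature =
  fixes seq :: "'c::{complete_lattice,distrib_lattice} \<Rightarrow> 'c \<Rightarrow> 'c"  (infixr \<open>;;\<close> 75)
    and nil :: 'c
begin

primrec iter :: "'c \<Rightarrow> nat \<Rightarrow> 'c" where
  "iter c 0 = nil"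
| "iter c (Suc i) = c ;; iter c i"

definition star :: "'c \<Rightarrow> 'c" where
  "star c = lfp (\<lambda>y. nil \<squnion> c ;; y)"

definition omega :: "'c \<Rightarrow> 'c" where
  "omega c = gfp (\<lambda>y. nil \<squnion> c ;; y)"

definition infiter :: "'c \<Rightarrow> 'c" where
  "infiter c = omega c ;; \<bottom>"

end

text \<open>Sequential composition is not assumed to distribute over joins, which is what would yield
  the last two facts about iteration; they are therefore assumed directly.\<close>

locale command_algebra = command_signature seq nil
  for seq :: "'c::{complete_lattice,distrib_lattice} \<Rightarrow> 'c \<Rightarrow> 'c"  (infixr \<open>;;\<close> 75)
    and nil :: 'c +
  fixes wconj :: "'c \<Rightarrow> 'c \<Rightarrow> 'c"  (infixr \<open>\<and>\<^sub>w\<close> 73)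
  assumes seq_assoc: "(c ;; d) ;; e = c ;; (d ;; e)"
    and nil_seq: "nil ;; c = c"
    and seq_nil: "c ;; nil = c"
    and seq_mono: "c \<le> c' \<Longrightarrow> d \<le> d' \<Longrightarrow> c ;; d \<le> c' ;; d'"
    and wconj_assoc: "(c \<and>\<^sub>w d) \<and>\<^sub>w e = c \<and>\<^sub>w (d \<and>\<^sub>w e)"
    and wconj_commute: "c \<and>\<^sub>w d = d \<and>\<^sub>w c"
    and wconj_idem: "c \<and>\<^sub>w c = c"
    and wconj_mono: "c \<le> c' \<Longrightarrow> d \<le> d' \<Longrightarrow> c \<and>\<^sub>w d \<le> c' \<and>\<^sub>w d'"
    and star_iter: "star c = (\<Squnion>i. iter c i)"
    and omega_decomp: "omega c = star c \<squnion> infiter c"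

section \<open>Primitive commands and rely\<close>

locale primitive_signature = command_signature seq nil
  for seq :: "'c::{complete_lattice,distrib_lattice} \<Rightarrow> 'c \<Rightarrow> 'c"  (infixr \<open>;;\<close> 75)
    and nil :: 'c +
  fixes V :: "'v set"
    and S :: "'s set"
    and pgm :: "('v \<rightharpoonup> 's) rel \<Rightarrow> 'c"  (\<open>\<pi>\<close>)
    and env :: "('v \<rightharpoonup> 's) rel \<Rightarrow> 'c"  (\<open>\<epsilon>\<close>)
begin

abbreviation "pgm_univ \<equiv> \<pi> (states V S \<times> states V S)"
abbreviation "env_univ \<equiv> \<epsilon> (states V S \<times> states V S)"

definition alpha :: 'c  (\<open>\<alpha>\<close>) where
  "\<alpha> = pgm_univ \<squnion> env_univ"

definition chaos :: 'c where
  "chaos = omega \<alpha>"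

definition rely :: "('v \<rightharpoonup> 's) rel \<Rightarrow> 'c" where
  "rely r = omega (\<alpha> \<squnion> \<epsilon> (rel_compl V S r) ;; \<top>)"

end

text \<open>The assumption \<open>rely_alt\<close> is included for the same reason.\<close>

locale rely_algebra =
  primitive_signature seq nil V S pgm env + command_algebra seq nil wconj
  for seq :: "'c::{complete_lattice,distrib_lattice} \<Rightarrow> 'c \<Rightarrow> 'c"  (infixr \<open>;;\<close> 75)
    and nil :: 'c
    and V :: "'v set"
    and S :: "'s set"
    and pgm :: "('v \<rightharpoonup> 's) rel \<Rightarrow> 'c"  (\<open>\<pi>\<close>)
    and env :: "('v \<rightharpoonup> 's) rel \<Rightarrow> 'c"  (\<open>\<epsilon>\<close>)
    and wconj :: "'c \<Rightarrow> 'c \<Rightarrow> 'c"  (infixr \<open>\<and>\<^sub>w\<close> 73) +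
  fixes tst :: "('v \<rightharpoonup> 's) set \<Rightarrow> 'c"  (\<open>\<tau>\<close>)
    and atomic :: "'c set"  (\<open>\<A>\<close>)
  assumes countable_vars: "countable V"
    and tst_embedding: "complete_boolean_embedding (states V S) \<tau>"
    and pgm_embedding: "complete_boolean_embedding (states V S \<times> states V S) \<pi>"
    and env_embedding: "complete_boolean_embedding (states V S \<times> states V S) \<epsilon>"
    and tst_empty: "\<tau> {} = \<bottom>"
    and pgm_empty: "\<pi> {} = \<bottom>"
    and env_empty: "\<epsilon> {} = \<bottom>"
    and tst_states: "\<tau> (states V S) = nil"
    and atomic_subalgebra: "complete_boolean_subalgebra \<A>"
    and pgm_atomic: "r \<subseteq> states V S \<times> states V S \<Longrightarrow> \<pi> r \<in> \<A>"
    and env_atomic: "r \<subseteq> states V S \<times> states V S \<Longrightarrow> \<epsilon> r \<in> \<A>"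
    and pgm_env_disjoint: "pgm_univ \<sqinter> env_univ = \<bottom>"
    and pgm_env_cover: "pgm_univ \<squnion> env_univ = \<Squnion>\<A>"
    and chaos_wconj: "chaos \<and>\<^sub>w c = c"
    and atomic_wconj: "a \<in> \<A> \<Longrightarrow> a = a \<and>\<^sub>w (\<alpha> ;; chaos)"
    and rely_alt: "r \<subseteq> states V S \<times> states V S \<Longrightarrow>
          rely r = omega \<alpha> ;; (nil \<squnion> \<epsilon> (rel_compl V S r) ;; \<top>)"

section \<open>Localisation\<close>

locale localisation_family =
  fixes V :: "'v set"
    and F :: "'v \<Rightarrow> 'c::{complete_lattice,distrib_lattice} \<Rightarrow> 'c"
  assumes extensive: "x \<in> V \<Longrightarrow> c \<le> F x c"
    and meet: "x \<in> V \<Longrightarrow> F x (c \<sqinter> F x d) = F x c \<sqinter> F x d"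
    and commute: "x \<in> V \<Longrightarrow> y \<in> V \<Longrightarrow> F x (F y c) = F y (F x c)"
    and Sup_distrib: "x \<in> V \<Longrightarrow> F x (\<Squnion>C) = (\<Squnion>c\<in>C. F x c)"

locale localised_rely_algebra =
  rely_algebra seq nil V S pgm env wconj tst atomic +
  E: localisation_family V E +
  Efirst: localisation_family V Efirst +
  Elast: localisation_family V Elast
  for seq :: "'c::{complete_lattice,distrib_lattice} \<Rightarrow> 'c \<Rightarrow> 'c"  (infixr \<open>;;\<close> 75)
    and nil :: 'c
    and V :: "'v set"
    and S :: "'s set"
    and pgm :: "('v \<rightharpoonup> 's) rel \<Rightarrow> 'c"  (\<open>\<pi>\<close>)
    and env :: "('v \<rightharpoonup> 's) rel \<Rightarrow> 'c"  (\<open>\<epsilon>\<close>)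
    and wconj :: "'c \<Rightarrow> 'c \<Rightarrow> 'c"  (infixr \<open>\<and>\<^sub>w\<close> 73)
    and tst :: "('v \<rightharpoonup> 's) set \<Rightarrow> 'c"  (\<open>\<tau>\<close>)
    and atomic :: "'c set"  (\<open>\<A>\<close>)
    and E :: "'v \<Rightarrow> 'c \<Rightarrow> 'c"
    and Efirst :: "'v \<Rightarrow> 'c \<Rightarrow> 'c"
    and Elast :: "'v \<Rightarrow> 'c \<Rightarrow> 'c" +
  assumes Efirst_le_E: "x \<in> V \<Longrightarrow> Efirst x c \<le> E x c"
    and Elast_le_E: "x \<in> V \<Longrightarrow> Elast x c \<le> E x c"
    and E_Efirst_commute: "x \<in> V \<Longrightarrow> y \<in> V \<Longrightarrow> E x (Efirst y c) = Efirst y (E x c)"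
    and E_Elast_commute: "x \<in> V \<Longrightarrow> y \<in> V \<Longrightarrow> E x (Elast y c) = Elast y (E x c)"
    and Efirst_Elast_commute: "x \<in> V \<Longrightarrow> y \<in> V \<Longrightarrow> Efirst x (Elast y c) = Elast y (Efirst x c)"
    and E_tst: "x \<in> V \<Longrightarrow> p \<subseteq> states V S \<Longrightarrow> E x (\<tau> p) = \<tau> (exists_set V S x p)"
    and Efirst_tst: "x \<in> V \<Longrightarrow> p \<subseteq> states V S \<Longrightarrow> Efirst x (\<tau> p) = \<tau> (exists_set V S x p)"
    and Elast_tst: "x \<in> V \<Longrightarrow> p \<subseteq> states V S \<Longrightarrow> Elast x (\<tau> p) = \<tau> (exists_set V S x p)"
    and E_pgm: "x \<in> V \<Longrightarrow> r \<subseteq> states V S \<times> states V S \<Longrightarrow>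
          E x (\<pi> r) = \<pi> (exists_rel V S x r)"
    and Efirst_pgm: "x \<in> V \<Longrightarrow> r \<subseteq> states V S \<times> states V S \<Longrightarrow>
          Efirst x (\<pi> r) = \<pi> (exists_first V S x r)"
    and Elast_pgm: "x \<in> V \<Longrightarrow> r \<subseteq> states V S \<times> states V S \<Longrightarrow>
          Elast x (\<pi> r) = \<pi> (exists_last V S x r)"
    and E_env: "x \<in> V \<Longrightarrow> r \<subseteq> states V S \<times> states V S \<Longrightarrow>
          E x (\<epsilon> r) = \<epsilon> (exists_rel V S x r)"
    and Efirst_env: "x \<in> V \<Longrightarrow> r \<subseteq> states V S \<times> states V S \<Longrightarrow>
          Efirst x (\<epsilon> r) = \<epsilon> (exists_first V S x r)"
    and Elast_env: "x \<in> V \<Longrightarrow> r \<subseteq> states V S \<times> states V S \<Longrightarrow>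
          Elast x (\<epsilon> r) = \<epsilon> (exists_last V S x r)"
    and E_seq_Efirst: "x \<in> V \<Longrightarrow> E x (c ;; Efirst x d) = E x c ;; E x d"
    and E_Elast_seq: "x \<in> V \<Longrightarrow> E x (Elast x c ;; d) = E x c ;; E x d"
    and Efirst_seq: "x \<in> V \<Longrightarrow> c = c \<and>\<^sub>w (\<alpha> ;; chaos) \<Longrightarrow> Efirst x (c ;; d) = Efirst x c ;; d"
    and Elast_seq: "x \<in> V \<Longrightarrow> c = c \<and>\<^sub>w (\<alpha> ;; chaos) \<Longrightarrow> Elast x (d ;; c) = d ;; Elast x c"
    and E_wconj: "x \<in> V \<Longrightarrow> E x (c \<and>\<^sub>w E x d) = E x c \<and>\<^sub>w E x d"
    and Efirst_wconj: "x \<in> V \<Longrightarrow> Efirst x (c \<and>\<^sub>w Efirst x d) = Efirst x c \<and>\<^sub>w Efirst x d"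

end

(* The identity reduces to localisation distributing over the sequential composition in the
   alternative form of rely, which needs the prefix omega alpha to be invariant under last
   localisation. Localising omega alpha gives a fixed point of the map that defines it as a
   greatest fixed point; hence E x fixes omega alpha, and so does Elast x, which lies between
   the identity and E x. *)
theory Submission
  imports Defs
begin

lemma (in localisation_family) sup_distrib:
  "x \<in> V \<Longrightarrow> F x (c \<squnion> d) = F x c \<squnion> F x d"
  using Sup_distrib[of x "{c, d}"] by simp

lemma (in localisation_family) top: "x \<in> V \<Longrightarrow> F x \<top> = \<top>"
  using extensive[of x \<top>] by (simp add: top_unique)

text \<open>\<open>id_except\<close> is reflexive on \<open>states V S\<close>, so localising the
  full set, or in the next two lemmas the full relation, loses nothing. This yields the invariance
  of \<open>nil\<close> and \<alpha>.\<close>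

lemma exists_set_states: "exists_set V S x (states V S) = states V S"
  by (auto simp: exists_set_def id_except_def)

lemma exists_last_states:
  "exists_last V S x (states V S \<times> states V S) = states V S \<times> states V S"
  by (auto simp: exists_last_def id_except_def)

lemma exists_rel_states:
  "exists_rel V S x (states V S \<times> states V S) = states V S \<times> states V S"
  by (auto simp: exists_rel_def id_except_def)

lemma exists_rel_subset: "exists_rel V S x r \<subseteq> states V S \<times> states V S"
  by (auto simp: exists_rel_def id_except_def)

lemma rel_compl_subset: "rel_compl V S r \<subseteq> states V S \<times> states V S"
  by (auto simp: rel_compl_def)

text \<open>\<open>exists_rel\<close> always lands in pairs of states, so the double relative
  complement cancels.\<close>

lemma rel_compl_forall_rel:
  "rel_compl V S (forall_rel V S x r) = exists_rel V S x (rel_compl V S r)"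
  using exists_rel_subset[of V S x "rel_compl V S r"]
  by (simp add: forall_rel_def rel_compl_def double_diff)

context command_algebra
begin

lemma mono_omega_step: "mono (\<lambda>y. nil \<squnion> c ;; y)"
  by (intro monoI sup_mono seq_mono order_refl)

lemma omega_unfold: "omega c = nil \<squnion> c ;; omega c"
  unfolding omega_def by (rule gfp_unfold[OF mono_omega_step])

lemma omega_greatest: "y \<le> nil \<squnion> c ;; y \<Longrightarrow> y \<le> omega c"
  unfolding omega_def by (rule gfp_upperbound)

end

context localised_rely_algebra
begin

text \<open>\<open>nil\<close> is the test of all states.\<close>

lemma E_nil: "x \<in> V \<Longrightarrow> E x nil = nil"
  using E_tst[of x "states V S"] by (simp add: tst_states exists_set_states)

lemma E_alpha: "x \<in> V \<Longrightarrow> E x \<alpha> = \<alpha>"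
  by (simp add: alpha_def E.sup_distrib E_pgm E_env exists_rel_states)

lemma Elast_alpha: "x \<in> V \<Longrightarrow> Elast x \<alpha> = \<alpha>"
  by (simp add: alpha_def Elast.sup_distrib Elast_pgm Elast_env exists_last_states)

lemma E_omega_alpha:
  assumes x: "x \<in> V"
  shows "E x (omega \<alpha>) = omega \<alpha>"
proof (rule antisym)
  have "E x (omega \<alpha>) = E x nil \<squnion> E x (\<alpha> ;; omega \<alpha>)"
    by (subst omega_unfold) (rule E.sup_distrib[OF x])
  \<comment> \<open>Since \<alpha> equals \<open>Elast x \<alpha>\<close>, the composition has the
    shape over which \<open>E x\<close> distributes.\<close>
  also have "E x (\<alpha> ;; omega \<alpha>) = \<alpha> ;; E x (omega \<alpha>)"
    using E_Elast_seq[OF x, of \<alpha> "omega \<alpha>"] by (simp add: x Elast_alpha E_alpha)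
  \<comment> \<open>Coinduction uses one half of the fixed-point equation:
    \<open>E x (omega \<alpha>)\<close> is a post-fixed point.\<close>
  finally show "E x (omega \<alpha>) \<le> omega \<alpha>"
    unfolding E_nil[OF x] by (intro omega_greatest eq_refl)
  show "omega \<alpha> \<le> E x (omega \<alpha>)"
    by (rule E.extensive[OF x])
qed

text \<open>The detour through \<open>E x\<close> is taken because \<open>Elast_seq\<close> asks the
  right factor to absorb \<open>\<alpha> ;; chaos\<close>; for \<open>omega \<alpha>\<close>, the
  identity of weak conjunction, this would mean \<open>chaos = \<alpha> ;; chaos\<close>.\<close>

lemma Elast_omega_alpha:
  assumes x: "x \<in> V"
  shows "Elast x (omega \<alpha>) = omega \<alpha>"
  using Elast_le_E[OF x, of "omega \<alpha>"] Elast.extensive[OF x, of "omega \<alpha>"]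
  by (simp add: E_omega_alpha[OF x])

lemma E_rely:
  assumes r: "r \<subseteq> states V S \<times> states V S" and x: "x \<in> V"
  shows "E x (rely r) = rely (forall_rel V S x r)"
proof -
  let ?q = "rel_compl V S r"
  \<comment> \<open>Here the right factor supplies the shape: \<top> equals
    \<open>Efirst x \<top>\<close>.\<close>
  have "E x (\<epsilon> ?q ;; \<top>) = \<epsilon> (exists_rel V S x ?q) ;; \<top>"
    using E_seq_Efirst[OF x, of "\<epsilon> ?q" \<top>]
    by (simp add: x Efirst.top E.top E_env rel_compl_subset)
  then have "E x (nil \<squnion> \<epsilon> ?q ;; \<top>) = nil \<squnion> \<epsilon> (exists_rel V S x ?q) ;; \<top>"
    by (simp add: x E.sup_distrib E_nil)
  \<comment> \<open>Now the left factor does: \<open>omega \<alpha>\<close> is read as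
    \<open>Elast x (omega \<alpha>)\<close>, and \<open>E x\<close> then leaves it
    unchanged.\<close>
  moreover have "E x (rely r) = omega \<alpha> ;; E x (nil \<squnion> \<epsilon> ?q ;; \<top>)"
    using E_Elast_seq[OF x, of "omega \<alpha>"]
    by (simp add: rely_alt[OF r] x Elast_omega_alpha E_omega_alpha)
  \<comment> \<open>\<open>rely_alt\<close> applies because \<open>forall_rel\<close> is itself a
    complement, hence a relation on states.\<close>
  moreover have "rely (forall_rel V S x r)
      = omega \<alpha> ;; (nil \<squnion> \<epsilon> (exists_rel V S x ?q) ;; \<top>)"
    using rely_alt[of "forall_rel V S x r"]
    unfolding rel_compl_forall_rel by (simp add: forall_rel_def rel_compl_subset)
  ultimately show ?thesis
    by simp
qed

end

theorem mainTheorem3: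
  fixes seq :: "'c::{complete_lattice,distrib_lattice} \<Rightarrow> 'c \<Rightarrow> 'c"
    and nil :: 'c
    and V :: "'v set" and S :: "'s set"
    and pgm env :: "('v \<rightharpoonup> 's) rel \<Rightarrow> 'c"
    and wconj :: "'c \<Rightarrow> 'c \<Rightarrow> 'c"
    and tst :: "('v \<rightharpoonup> 's) set \<Rightarrow> 'c"
    and atomic :: "'c set"
    and E Efirst Elast :: "'v \<Rightarrow> 'c \<Rightarrow> 'c"
    and r :: "('v \<rightharpoonup> 's) rel" and x :: 'v
  assumes "localised_rely_algebra seq nil V S pgm env wconj tst atomic E Efirst Elast"
    and "r \<subseteq> states V S \<times> states V S"
    and "x \<in> V"
  shows "E x (primitive_signature.rely seq nil V S pgm env r) =
         primitive_signature.rely seq nil V S pgm env (forall_rel V S x r)"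
  using assms by (rule localised_rely_algebra.E_rely)

end
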